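(* Let $N\ge 5$ be an integer, and write $N=3k+i$ with $k\in\mathbb{N}$ and $i\in\{0,1,2\}$. Let $SP^N_*$ denote the maximal number of finite paths ending in the sink, over all connected acyclic directed graphs with exactly $N$ edges and exactly one sink. Then $$SP^N_*=\begin{cases}\frac12\left(11\cdot 3^{k-1}-1\right) & \text{if } i=0,\\[2pt] \frac12\left(47\cdot 3^{k-2}-1\right) & \text{if } i=1,\\[2pt] \frac12\left(23\cdot 3^{k-1}-1\right) & \text{if } i=2.\end{cases}$$
   Context: A directed graph $E=(E^0,E^1,s_E,t_E)$ consists of a set of vertices $E^0$, a set of edges $E^1$, and source and target maps $s_E,t_E\colon E^1\to E^0$ (multiple edges are allowed). A finite path of length $n\ge1$ is a tuple $(e_1,\dots,e_n)$ of edges with $t_E(e_i)=s_E(e_{i+1})$ for $1\le i<n$; it ends at $t_E(e_n)$. Vertices are paths of length $0$, ending at themselves. $E$ is acyclic if it has no path of positive length whose beginning and end coincide; $E$ is connected if any two vertices are joined by a finite undirected path. A sink is a vertex emitting no edges. *)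

theory Defs
  imports Complex_Main "Graph_Theory.Graph_Theory"
begin

definition is_sink :: "('v, 'e) pre_digraph \<Rightarrow> 'v \<Rightarrow> bool" where
  "is_sink G v \<longleftrightarrow> v \<in> verts G \<and> out_arcs G v = {}"

definition acyclic_digraph :: "('v, 'e) pre_digraph \<Rightarrow> bool" where
  "acyclic_digraph G \<longleftrightarrow> \<not> (\<exists>u p. pre_digraph.awalk G u p u \<and> p \<noteq> [])"

(* A path is recorded with its starting vertex, so that the paths of length 0 are the
   pairs (u, []), one for each vertex u.  Vertices may repeat (awalk, not apath). *)
definition paths_ending_at :: "('v, 'e) pre_digraph \<Rightarrow> 'v \<Rightarrow> ('v \<times> 'e list) set" where
  "paths_ending_at G v = {(u, p). pre_digraph.awalk G u p v}"

(* The vertex set is not required to be finite; it is so by connectedness.  Finiteness of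
   the arc set is explicit because card is 0 on infinite sets. *)
definition one_sink_dag :: "nat \<Rightarrow> ('v, 'e) pre_digraph \<Rightarrow> bool" where
  "one_sink_dag N G \<longleftrightarrow>
     wf_digraph G \<and> connected G \<and> acyclic_digraph G \<and>
     finite (arcs G) \<and> card (arcs G) = N \<and> (\<exists>!v. is_sink G v)"

definition sink_path_counts :: "'v itself \<Rightarrow> 'e itself \<Rightarrow> nat \<Rightarrow> nat set" where
  "sink_path_counts _ _ N =
     {card (paths_ending_at G v) | (G :: ('v, 'e) pre_digraph) v.
        one_sink_dag N G \<and> is_sink G v}"

(* A connected digraph with finitely many arcs is isomorphic to one whose vertices and arcs
   are natural numbers, so the maximum over all such graphs can be taken over those.  Max is
   meaningful only for a finite nonempty set; statements about SP_star should therefore also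
   assert that it is attained and is an upper bound. *)
definition SP_star :: "nat \<Rightarrow> nat" where
  "SP_star N = Max (sink_path_counts TYPE(nat) TYPE(nat) N)"

end

theory Submission
  imports Defs "HOL-Library.Nat_Bijection"
begin

text \<open>
  List the vertices of the graph so that every arc points to an earlier vertex, starting with the
  sink, and let \<open>d\<^sub>1, d\<^sub>2, \<dots>\<close> be the out-degrees of the vertices after the sink.  By induction,
  at most \<open>d\<^sub>1 \<cdots> d\<^sub>j\<close> paths lead from the \<open>j\<close>-th of these to the sink, so there are at most
  \<open>1 + d\<^sub>1 + d\<^sub>1 d\<^sub>2 + \<dots>\<close> paths in total, with equality for the chain whose consecutive vertices
  are joined by \<open>d\<^sub>j\<close> parallel arcs.  It remains to maximise this sum over the compositions
  of \<open>N\<close>.  Its Horner form \<open>1 + d\<^sub>1 (1 + d\<^sub>2 (\<dots>))\<close> gives a recursion for the maximum, which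
  from \<open>N = 8\<close> on is solved by \<open>d\<^sub>1 = 3\<close>.
\<close>

section \<open>Maximising over compositions\<close>

fun chain_paths :: "nat list \<Rightarrow> nat" where
  "chain_paths [] = 1"
| "chain_paths (d # ds) = 1 + d * chain_paths ds"

text \<open>The recursion adds a vertex next to the sink, whereas the induction over the graph adds
  one at the far end of the list; this form serves the latter.\<close>

lemma chain_paths_snoc: "chain_paths (ds @ [d]) = chain_paths ds + prod_list ds * d"
  by (induction ds) (auto simp: algebra_simps)

lemma chain_paths_eq_sum: "chain_paths ds = (\<Sum>j\<le>length ds. prod_list (take j ds))"
  by (induction ds rule: rev_induct) (auto simp: chain_paths_snoc)

text \<open>The maxima of \<open>chain_paths\<close> over compositions of \<open>n\<close>. The
  table runs up to 7 because the recursion still fails there: 1 + 3 * 7 = 22 < 23.\<close>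

fun max_chain_paths :: "nat \<Rightarrow> nat" where
  "max_chain_paths n =
     (if n < 8 then [1, 2, 3, 5, 7, 11, 16, 23] ! n else 1 + 3 * max_chain_paths (n - 3))"

declare max_chain_paths.simps [simp del]

lemma max_chain_paths_rec: "n \<ge> 5 \<Longrightarrow> max_chain_paths (n + 3) = 1 + 3 * max_chain_paths n"
  by (subst max_chain_paths.simps) simp

lemma max_chain_paths_base:
  "max_chain_paths 0 = 1" "max_chain_paths (Suc 0) = 2" "max_chain_paths 2 = 3"
  "max_chain_paths 3 = 5" "max_chain_paths 4 = 7" "max_chain_paths 5 = 11"
  "max_chain_paths 6 = 16" "max_chain_paths 7 = 23" "max_chain_paths 8 = 34" "max_chain_paths 9 = 49"
  by (simp_all add: max_chain_paths.simps)

lemma less_8_cases: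
  "(n::nat) < 8 \<Longrightarrow> n \<in> {0, Suc 0, 2, 3, 4, 5, 6, 7}"
  by auto

text \<open>From \<open>n = 5\<close> on this is the recursion, with equality; below that it is a
  finite check, strict at 0, 2 and 4.\<close>

lemma max_chain_paths_step3: "1 + 3 * max_chain_paths n \<le> max_chain_paths (n + 3)"
proof (cases "n < 5")
  case True
  then have "n \<in> {0, Suc 0, 2, 3, 4}" by auto
  then show ?thesis by (auto simp: max_chain_paths_base)
qed (simp add: max_chain_paths_rec)

text \<open>From 8 on all values involved arise from those three places earlier by x \<mapsto> 1 +
  3x, and 1 + cx \<le> y with c \<le> 3 implies 1 + c(1 + 3x) \<le> 1 + 3y. This leaves the cases
  \<open>n < 8\<close>.\<close>

lemma max_chain_paths_step12:
  "1 + max_chain_paths n \<le> max_chain_paths (n + 1) \<and>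
   1 + 2 * max_chain_paths n \<le> max_chain_paths (n + 2)"
proof (induction n rule: less_induct)
  case (less n)
  show ?case
  proof (cases "n < 8")
    case True
    then show ?thesis
      using less_8_cases [OF True] by (auto simp: max_chain_paths_base simp flip: numeral_2_eq_2 numeral_3_eq_3)
  next
    case False
    then have n: "n = (n - 3) + 3" "n + 1 = (n - 3 + 1) + 3" "n + 2 = (n - 3 + 2) + 3"
      and ge: "n - 3 \<ge> 5" by auto
    have "max_chain_paths n = 1 + 3 * max_chain_paths (n - 3)"
      "max_chain_paths (n + 1) = 1 + 3 * max_chain_paths (n - 3 + 1)"
      "max_chain_paths (n + 2) = 1 + 3 * max_chain_paths (n - 3 + 2)"
      using max_chain_paths_rec [of "n - 3"] max_chain_paths_rec [of "n - 3 + 1"]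
        max_chain_paths_rec [of "n - 3 + 2"] n ge by (metis le_add1 le_trans)+
    then show ?thesis
      using less.IH [of "n - 3"] False by auto
  qed
qed

text \<open>Splitting a large entry loses nothing: 4 becomes 2 and 2, and \<open>d \<ge> 5\<close>
  becomes \<open>d - 3\<close> and 3. So the inequalities for 1, 2 and 3 suffice.\<close>

lemma max_chain_paths_step:
  "d \<ge> 1 \<Longrightarrow> 1 + d * max_chain_paths n \<le> max_chain_paths (n + d)"
proof (induction d arbitrary: n rule: less_induct)
  case (less d)
  consider "d = 1" | "d = 2" | "d = 3" | "d = 4" | "d \<ge> 5"
    using less.prems by linarith
  then show ?case
  proof cases
    case 4
    then show ?thesis
      using max_chain_paths_step12 [of n] max_chain_paths_step12 [of "n + 2"]
      by (simp add: numeral_eq_Suc)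
  next
    case 5
    \<comment> \<open>Here \<open>d \<le> 3 * (d - 3)\<close> is used; it fails for 4, hence the
      separate case.\<close>
    have "d * max_chain_paths n \<le> (3 * (d - 3)) * max_chain_paths n"
      by (rule mult_right_mono) (use 5 in auto)
    then have "d * max_chain_paths n \<le> 3 * ((d - 3) * max_chain_paths n)"
      by (simp only: mult.assoc)
    moreover have "1 + (d - 3) * max_chain_paths n \<le> max_chain_paths (n + (d - 3))"
      using less.IH [of "d - 3"] 5 by auto
    moreover have "1 + 3 * max_chain_paths (n + (d - 3)) \<le> max_chain_paths (n + d)"
      using max_chain_paths_step3 [of "n + (d - 3)"] 5 by (simp add: add.assoc)
    ultimately show ?thesis
      by linarith
  qed (use max_chain_paths_step12 [of n] max_chain_paths_step3 [of n] in auto)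
qed

lemma chain_paths_le_max: "0 \<notin> set ds \<Longrightarrow> chain_paths ds \<le> max_chain_paths (sum_list ds)"
proof (induction ds)
  case (Cons d ds)
  then have "1 + d * chain_paths ds \<le> 1 + d * max_chain_paths (sum_list ds)"
    by simp
  also have "\<dots> \<le> max_chain_paths (sum_list ds + d)"
    using max_chain_paths_step Cons.prems by simp
  finally show ?case
    by (simp add: add.commute)
qed (simp add: max_chain_paths_base)

lemma max_chain_paths_attained:
  "\<exists>ds. 0 \<notin> set ds \<and> sum_list ds = n \<and> chain_paths ds = max_chain_paths n"
proof (induction n rule: less_induct)
  case (less n)
  show ?case
  proof (cases "n < 8")
    case True
    let ?P = "\<lambda>n ds. 0 \<notin> set ds \<and> sum_list ds = n \<and> chain_paths ds = max_chain_paths n"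
    \<comment> \<open>Optimal compositions for the tabulated values; from 8 on, prepending 3
      preserves optimality.\<close>
    have "?P 0 []" "?P (Suc 0) [1]" "?P 2 [1, 1]" "?P 3 [2, 1]" "?P 4 [2, 1, 1]"
      "?P 5 [2, 2, 1]" "?P 6 [3, 2, 1]" "?P 7 [2, 2, 2, 1]"
      by (simp_all add: max_chain_paths_base)
    then show ?thesis
      using less_8_cases [OF True] by blast
  next
    case False
    then obtain ds where "0 \<notin> set ds" "sum_list ds = n - 3"
      "chain_paths ds = max_chain_paths (n - 3)"
      using less.IH [of "n - 3"] by auto
    then show ?thesis
      using False max_chain_paths_rec [of "n - 3"] by (intro exI [of _ "3 # ds"]) auto
  qed
qed

text \<open>Passing from x to 2x + 1 turns the recursion x \<mapsto> 1 + 3x into multiplication by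
  3.\<close>

lemma max_chain_paths_closed_form:
  "2 * max_chain_paths (3 * k + 6) + 1 = 11 * 3 ^ (k + 1)"
  "2 * max_chain_paths (3 * k + 7) + 1 = 47 * 3 ^ k"
  "2 * max_chain_paths (3 * k + 5) + 1 = 23 * 3 ^ k"
proof (induction k)
  case (Suc k)
  have "3 * Suc k + 6 = 3 * k + 6 + 3" "3 * Suc k + 7 = 3 * k + 7 + 3" "3 * Suc k + 5 = 3 * k + 5 + 3"
    by simp_all
  then have "max_chain_paths (3 * Suc k + 6) = 1 + 3 * max_chain_paths (3 * k + 6)"
    "max_chain_paths (3 * Suc k + 7) = 1 + 3 * max_chain_paths (3 * k + 7)"
    "max_chain_paths (3 * Suc k + 5) = 1 + 3 * max_chain_paths (3 * k + 5)"
    by (simp_all only: max_chain_paths_rec le_add2)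
  then show "2 * max_chain_paths (3 * Suc k + 6) + 1 = 11 * 3 ^ (Suc k + 1)"
    "2 * max_chain_paths (3 * Suc k + 7) + 1 = 47 * 3 ^ Suc k"
    "2 * max_chain_paths (3 * Suc k + 5) + 1 = 23 * 3 ^ Suc k"
    using Suc.IH by simp_all
qed (simp_all add: max_chain_paths_base)

section \<open>Counting walks to the sink\<close>

definition walks :: "('v, 'e) pre_digraph \<Rightarrow> 'v \<Rightarrow> 'v \<Rightarrow> 'e list set" where
  "walks G s v = {p. pre_digraph.awalk G v p s}"

lemma walks_sink:
  assumes "wf_digraph G" "acyclic_digraph G" "is_sink G s"
  shows "walks G s s = {[]}"
proof -
  interpret wf_digraph G by fact
  show ?thesis
    using assms(2,3) by (auto simp: walks_def acyclic_digraph_def is_sink_def awalk_Nil_iff)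
qed

text \<open>A walk from \<open>v \<noteq> s\<close> to \<open>s\<close> is nonempty and splits
  uniquely into its first arc and a walk from the head of that arc.\<close>

lemma card_walks_step:
  assumes "wf_digraph G" "v \<in> verts G" "v \<noteq> s" "finite (out_arcs G v)"
    and fin: "\<And>e. e \<in> out_arcs G v \<Longrightarrow> finite (walks G s (head G e))"
  shows "finite (walks G s v)"
    and "card (walks G s v) = (\<Sum>e\<in>out_arcs G v. card (walks G s (head G e)))"
proof -
  interpret wf_digraph G by fact
  let ?S = "SIGMA e:out_arcs G v. walks G s (head G e)"
  have eq: "walks G s v = (\<lambda>(e, p). e # p) ` ?S"
  proof (intro set_eqI iffI)
    fix p assume "p \<in> walks G s v"
    then show "p \<in> (\<lambda>(e, p). e # p) ` ?S"
      using assms(2,3)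
      by (cases p) (auto simp: walks_def awalk_Nil_iff awalk_Cons_iff out_arcs_def image_iff)
  qed (auto simp: walks_def awalk_Cons_iff out_arcs_def)
  have "finite ?S"
    using assms(4) fin by auto
  then show "finite (walks G s v)"
    by (simp add: eq)
  have "inj_on (\<lambda>(e, p). e # p) ?S"
    by (auto simp: inj_on_def)
  then show "card (walks G s v) = (\<Sum>e\<in>out_arcs G v. card (walks G s (head G e)))"
    using assms(4) fin by (simp add: eq card_image card_SigmaI)
qed

lemma card_paths_ending_at:
  assumes "finite (verts G)" "\<And>v. v \<in> verts G \<Longrightarrow> finite (walks G s v)"
  shows "card (paths_ending_at G s) = (\<Sum>v\<in>verts G. card (walks G s v))"
proof -
  have "paths_ending_at G s = (SIGMA v:verts G. walks G s v)"
    by (auto simp: paths_ending_at_def walks_def pre_digraph.awalk_def)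
  then show ?thesis
    using assms by (simp add: card_SigmaI)
qed

section \<open>The upper bound\<close>

text \<open>A minimal element of a vertex set for this relation is a vertex that no arc from within
  the set enters.\<close>

lemma acyclic_digraph_wf:
  assumes "wf_digraph G" "acyclic_digraph G" "finite (arcs G)"
  shows "wf (arcs_ends G)"
proof -
  interpret wf_digraph G by fact
  have "acyclic (arcs_ends G)"
    using assms(2) by (auto simp: acyclic_def reachable1_awalk acyclic_digraph_def)
  then show ?thesis
    using assms(3) by (intro finite_acyclic_wf) (auto simp: arcs_ends_def)
qed

text \<open>The set \<open>A\<close> plays the role of an initial segment of the vertex list: it is closed under
  following arcs, and the induction removes a vertex of \<open>A\<close> that no arc from within \<open>A\<close> enters.\<close>

lemma walks_bound_closed_set:
  assumes "wf_digraph G" "acyclic_digraph G" "finite (arcs G)" "is_sink G s"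
    and "finite A" "s \<in> A" "A \<subseteq> verts G"
    and "\<And>e. e \<in> arcs G \<Longrightarrow> tail G e \<in> A \<Longrightarrow> head G e \<in> A"
    and "\<And>v. v \<in> A \<Longrightarrow> v \<noteq> s \<Longrightarrow> out_arcs G v \<noteq> {}"
  shows "\<exists>ds. 0 \<notin> set ds \<and> sum_list ds = card {e \<in> arcs G. tail G e \<in> A} \<and>
    (\<forall>v\<in>A. finite (walks G s v) \<and> card (walks G s v) \<le> prod_list ds) \<and>
    (\<Sum>v\<in>A. card (walks G s v)) \<le> chain_paths ds"
  using assms(5-9)
proof (induction A rule: finite_psubset_induct)
  case (psubset A)
  note closed = psubset.prems(3) and nonsink = psubset.prems(4)
  have no_out: "tail G e \<noteq> s" if "e \<in> arcs G" for e
    using that assms(4) by (auto simp: is_sink_def out_arcs_def)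
  show ?case
  proof (cases "A = {s}")
    case True
    then have "card {e \<in> arcs G. tail G e \<in> A} = 0"
      using no_out by (auto simp: card_eq_0_iff)
    then show ?thesis
      using walks_sink [OF assms(1,2,4)] by (intro exI [of _ "[]"]) (simp add: True)
  next
    case False
    then have "A - {s} \<noteq> {}"
      using psubset.prems(1) by auto
    then obtain u where u: "u \<in> A - {s}" and "\<And>x. (x, u) \<in> arcs_ends G \<Longrightarrow> x \<notin> A - {s}"
      using wfE_min [OF acyclic_digraph_wf [OF assms(1-3)], of _ "A - {s}"] by (metis ex_in_conv)
    \<comment> \<open>Minimality excludes arcs from \<open>A - {s}\<close>, and the sink emits none,
      so no arc from \<open>A\<close> enters \<open>u\<close>. Hence \<open>A - {u}\<close> is again
      closed.\<close>
    then have src: "head G e \<noteq> u" if "e \<in> arcs G" "tail G e \<in> A" for e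
      using that no_out [of e] by (force simp: arcs_ends_def arc_to_ends_def)
    define B where "B = A - {u}"
    have B: "B \<subset> A" "s \<in> B" "B \<subseteq> verts G" "finite B" "u \<notin> B" "A = insert u B"
      using u psubset.prems(1,2) psubset.hyps by (auto simp: B_def)
    obtain ds where ds: "0 \<notin> set ds" "sum_list ds = card {e \<in> arcs G. tail G e \<in> B}"
      "\<And>v. v \<in> B \<Longrightarrow> finite (walks G s v)"
      "\<And>v. v \<in> B \<Longrightarrow> card (walks G s v) \<le> prod_list ds"
      "(\<Sum>v\<in>B. card (walks G s v)) \<le> chain_paths ds"
      using psubset.IH [OF B(1-3)] closed src nonsink by (auto simp: B_def)
    have fin: "finite (out_arcs G u)"
      using assms(3) by (simp add: out_arcs_def)
    have head_B: "head G e \<in> B" if "e \<in> out_arcs G u" for e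
      using that closed [of e] src [of e] u by (auto simp: out_arcs_def B_def)
    let ?d = "card (out_arcs G u)"
    have d: "?d \<noteq> 0"
      using fin nonsink [of u] u by auto
    have walks_u: "finite (walks G s u)"
      "card (walks G s u) = (\<Sum>e\<in>out_arcs G u. card (walks G s (head G e)))"
      using card_walks_step [OF assms(1) _ _ fin] u psubset.prems(2) ds(3) head_B by auto
    \<comment> \<open>Each of the \<open>?d\<close> arcs leaving \<open>u\<close> ends in
      \<open>B\<close>, where the induction hypothesis bounds the walks uniformly by
      \<open>prod_list ds\<close>.\<close>
    have "card (walks G s u) \<le> ?d * prod_list ds"
      unfolding walks_u using sum_bounded_above [of "out_arcs G u" _ "prod_list ds"] ds(4) head_B
      by fastforce
    moreover have "{e \<in> arcs G. tail G e \<in> A} = {e \<in> arcs G. tail G e \<in> B} \<union> out_arcs G u"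
      using B(6) by (auto simp: out_arcs_def)
    then have "card {e \<in> arcs G. tail G e \<in> A} = card {e \<in> arcs G. tail G e \<in> B} + ?d"
      using assms(3) fin B(5) by (subst card_Un_disjoint [symmetric]) (auto simp: out_arcs_def)
    \<comment> \<open>As \<open>?d \<ge> 1\<close>, the larger product still bounds the old
      vertices. The walks from \<open>u\<close> are covered by the last summand of
      \<open>chain_paths (ds @ [?d])\<close>.\<close>
    moreover have "\<forall>v\<in>B. card (walks G s v) \<le> prod_list ds * ?d"
      using d ds(4) by (fastforce intro: le_trans)
    ultimately show ?thesis
      using ds d walks_u(1) B(4-6)
      by (intro exI [of _ "ds @ [?d]"])
        (auto simp: chain_paths_snoc mult.commute)
  qed
qed

lemma card_paths_ending_at_le:
  assumes "one_sink_dag N G" "is_sink G s"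
  shows "card (paths_ending_at G s) \<le> max_chain_paths N"
proof -
  have G: "wf_digraph G" "acyclic_digraph G" "finite (arcs G)" "card (arcs G) = N"
    using assms(1) by (auto simp: one_sink_dag_def)
  interpret wf_digraph G by fact
  have out: "out_arcs G v \<noteq> {}" if "v \<in> verts G" "v \<noteq> s" for v
    using assms that by (auto simp: one_sink_dag_def is_sink_def)
  \<comment> \<open>Every vertex but the sink is the tail of an arc, so finitely many arcs give
    finitely many vertices.\<close>
  then have "verts G \<subseteq> insert s (tail G ` arcs G)"
    by (fastforce simp: out_arcs_def)
  then have fin: "finite (verts G)"
    using G(3) finite_subset by blast
  have "{e \<in> arcs G. tail G e \<in> verts G} = arcs G"
    by auto
  moreover have "s \<in> verts G"
    using assms(2) by (simp add: is_sink_def)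
  ultimately obtain ds where "0 \<notin> set ds" "sum_list ds = N"
    "\<forall>v\<in>verts G. finite (walks G s v)" "(\<Sum>v\<in>verts G. card (walks G s v)) \<le> chain_paths ds"
    using walks_bound_closed_set [OF G(1-3) assms(2) fin] out G(4) by auto
  then show ?thesis
    using chain_paths_le_max [of ds] card_paths_ending_at [OF fin, of s] by auto
qed

section \<open>Chains attain the bound\<close>

text \<open>The arc \<open>prod_encode (j, r)\<close> is the \<open>r\<close>-th of the \<open>ds ! j\<close> parallel arcs from \<open>Suc j\<close> to \<open>j\<close>.\<close>

definition chain_graph :: "nat list \<Rightarrow> (nat, nat) pre_digraph" where
  "chain_graph ds =
    \<lparr>verts = {..length ds},
     arcs = prod_encode ` (SIGMA j:{..<length ds}. {..<ds ! j}),
     tail = (\<lambda>e. Suc (fst (prod_decode e))),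
     head = (\<lambda>e. fst (prod_decode e))\<rparr>"

lemma out_arcs_chain_graph:
  "out_arcs (chain_graph ds) 0 = {}"
  "j < length ds \<Longrightarrow> out_arcs (chain_graph ds) (Suc j) = (\<lambda>r. prod_encode (j, r)) ` {..<ds ! j}"
  by (auto simp: out_arcs_def chain_graph_def)

lemma tail_chain_graph: "tail (chain_graph ds) e = Suc (head (chain_graph ds) e)"
  by (simp add: chain_graph_def)

lemma wf_chain_graph: "wf_digraph (chain_graph ds)"
  by unfold_locales (auto simp: chain_graph_def)

text \<open>Every arc lowers the vertex number by one, so a nonempty walk cannot return to its
  start.\<close>

lemma acyclic_chain_graph: "acyclic_digraph (chain_graph ds)"
proof -
  interpret wf_digraph "chain_graph ds" by (rule wf_chain_graph)
  have dec: "v \<le> u \<and> (p \<noteq> [] \<longrightarrow> v < u)" if "awalk u p v" for u p v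
    using that
  proof (induction p arbitrary: u)
    case (Cons e p)
    then have "Suc (head (chain_graph ds) e) = u" "awalk (head (chain_graph ds) e) p v"
      by (auto simp: awalk_Cons_iff tail_chain_graph)
    then show ?case
      using Cons.IH by (metis le_imp_less_Suc less_imp_le)
  qed (simp add: awalk_Nil_iff)
  show ?thesis
    unfolding acyclic_digraph_def using dec by blast
qed

text \<open>A zero entry \<open>ds ! j\<close> would make \<open>Suc j\<close> a further
  sink.\<close>

lemma is_sink_chain_graph_iff:
  assumes "0 \<notin> set ds"
  shows "is_sink (chain_graph ds) v \<longleftrightarrow> v = 0"
proof (cases v)
  case (Suc j)
  have "ds ! j \<noteq> 0" if "j < length ds"
    using assms that by (metis nth_mem)
  then show ?thesis
    using Suc out_arcs_chain_graph(2) [of j ds]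
    by (auto simp: is_sink_def chain_graph_def lessThan_empty_iff)
qed (simp add: is_sink_def out_arcs_chain_graph, simp add: chain_graph_def)

text \<open>Any two vertices are joined through 0, so walks to and from 0 in the symmetric closure
  are built along the chain.\<close>

lemma connected_chain_graph:
  assumes "0 \<notin> set ds"
  shows "connected (chain_graph ds)"
proof -
  let ?V = "verts (chain_graph ds)" and ?R = "(arcs_ends (chain_graph ds))\<^sup>s"
  have to_0: "(v, 0) \<in> rtrancl_on ?V ?R \<and> (0, v) \<in> rtrancl_on ?V ?R" if "v \<in> ?V" for v
    using that
  proof (induction v)
    case (Suc j)
    then have j: "j < length ds" "j \<in> ?V"
      by (auto simp: chain_graph_def)
    then have "ds ! j > 0"
      using assms by (metis gr0I nth_mem)
    then have "(Suc j, j) \<in> arcs_ends (chain_graph ds)"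
      using j(1) by (force simp: arcs_ends_def arc_to_ends_def chain_graph_def)
    then have "(Suc j, j) \<in> ?R" "(j, Suc j) \<in> ?R"
      by (auto simp: symcl_def)
    then show ?case
      using Suc j(2) by (meson converse_rtrancl_on_into_rtrancl_on rtrancl_on_into_rtrancl_on)
  qed auto
  interpret wf_digraph "chain_graph ds" by (rule wf_chain_graph)
  show ?thesis
    unfolding connected_conv using to_0 by (auto simp: chain_graph_def intro: rtrancl_on_trans)
qed

lemma finite_arcs_chain_graph: "finite (arcs (chain_graph ds))"
  by (simp add: chain_graph_def)

lemma card_arcs_chain_graph: "card (arcs (chain_graph ds)) = sum_list ds"
  by (simp add: chain_graph_def card_image inj_prod_encode sum_list_sum_nth atLeast0LessThan)

lemma one_sink_dag_chain_graph:
  "0 \<notin> set ds \<Longrightarrow> one_sink_dag (sum_list ds) (chain_graph ds)"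
  unfolding one_sink_dag_def
  by (auto simp: wf_chain_graph connected_chain_graph acyclic_chain_graph card_arcs_chain_graph
      is_sink_chain_graph_iff finite_arcs_chain_graph)

text \<open>All arcs leaving \<open>Suc j\<close> lead to \<open>j\<close>, so the estimate of the
  upper bound becomes an equality.\<close>

lemma card_walks_chain_graph:
  assumes "0 \<notin> set ds" "j \<le> length ds"
  shows "finite (walks (chain_graph ds) 0 j) \<and>
    card (walks (chain_graph ds) 0 j) = prod_list (take j ds)"
  using assms(2)
proof (induction j)
  case 0
  have "walks (chain_graph ds) 0 0 = {[]}"
    by (intro walks_sink wf_chain_graph acyclic_chain_graph)
      (simp add: is_sink_chain_graph_iff [OF assms(1)])
  then show ?case by simp
next
  case (Suc j)
  let ?G = "chain_graph ds"
  have out: "out_arcs ?G (Suc j) = (\<lambda>r. prod_encode (j, r)) ` {..<ds ! j}"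
    using Suc.prems by (intro out_arcs_chain_graph(2)) simp
  then have head: "head ?G e = j" if "e \<in> out_arcs ?G (Suc j)" for e
    using that by (auto simp: chain_graph_def)
  have card: "card (out_arcs ?G (Suc j)) = ds ! j"
    unfolding out by (subst card_image) (auto simp: inj_on_def)
  have "finite (out_arcs ?G (Suc j))" "Suc j \<in> verts ?G"
    using out Suc.prems by (simp_all add: chain_graph_def)
  then show ?case
    using card_walks_step [OF wf_chain_graph, of "Suc j" ds 0] head card Suc
    by (simp add: take_Suc_conv_app_nth)
qed

lemma card_paths_chain_graph:
  assumes "0 \<notin> set ds"
  shows "card (paths_ending_at (chain_graph ds) 0) = chain_paths ds"
proof -
  have "verts (chain_graph ds) = {..length ds}"
    by (simp add: chain_graph_def)
  then show ?thesis
    using card_paths_ending_at [of "chain_graph ds" 0] card_walks_chain_graph [OF assms]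
    by (simp add: chain_paths_eq_sum)
qed

section \<open>The maximum over all graphs and its closed form\<close>

lemma sink_path_counts_le:
  "n \<in> sink_path_counts TYPE('v) TYPE('e) N \<Longrightarrow> n \<le> max_chain_paths N"
  by (auto simp: sink_path_counts_def intro: card_paths_ending_at_le)

lemma max_chain_paths_in_sink_path_counts:
  "max_chain_paths N \<in> sink_path_counts TYPE(nat) TYPE(nat) N"
proof -
  obtain ds where ds: "0 \<notin> set ds" "sum_list ds = N" "chain_paths ds = max_chain_paths N"
    using max_chain_paths_attained by blast
  then have "max_chain_paths N = card (paths_ending_at (chain_graph ds) 0)"
    "one_sink_dag N (chain_graph ds)" "is_sink (chain_graph ds) 0"
    using card_paths_chain_graph one_sink_dag_chain_graph is_sink_chain_graph_iff by auto
  then show ?thesis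
    unfolding sink_path_counts_def by blast
qed

text \<open>The bound, attained by a chain, also makes the set of counts finite, as
  \<open>Max\<close> requires.\<close>

lemma SP_star_eq: "SP_star N = max_chain_paths N"
  unfolding SP_star_def
proof (rule Max_eqI)
  show "finite (sink_path_counts TYPE(nat) TYPE(nat) N)"
    by (rule finite_subset [of _ "{..max_chain_paths N}"]) (auto intro: sink_path_counts_le)
qed (auto intro: sink_path_counts_le max_chain_paths_in_sink_path_counts)

theorem theorem4p12:
  fixes N k i :: nat
  assumes "N \<ge> 5" and "N = 3 * k + i" and "i \<in> {0, 1, 2}"
  shows "SP_star N \<in> sink_path_counts TYPE(nat) TYPE(nat) N
    \<and> (\<forall>n \<in> sink_path_counts TYPE('v) TYPE('e) N. n \<le> SP_star N)
    \<and> (\<forall>n \<in> sink_path_counts TYPE(nat) TYPE(nat) N. n \<le> SP_star N)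
    \<and> real (SP_star N) =
        (if i = 0 then 1 / 2 * (11 * 3 ^ (k - 1) - 1)
         else if i = 1 then 1 / 2 * (47 * 3 ^ (k - 2) - 1)
         else 1 / 2 * (23 * 3 ^ (k - 1) - 1))"
proof -
  have half: "real a = 1 / 2 * (real c * 3 ^ m - 1)" if "2 * a + 1 = c * 3 ^ m" for a c m
  proof -
    have "real (2 * a + 1) = real (c * 3 ^ m)"
      by (simp only: that)
    then show ?thesis by simp
  qed
  have "real (max_chain_paths N) =
        (if i = 0 then 1 / 2 * (11 * 3 ^ (k - 1) - 1)
         else if i = 1 then 1 / 2 * (47 * 3 ^ (k - 2) - 1)
         else 1 / 2 * (23 * 3 ^ (k - 1) - 1))"
  proof -
    \<comment> \<open>\<open>N \<ge> 5\<close> forces these bounds on \<open>k\<close>, so no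
      subtraction in the exponents is truncated.\<close>
    consider "i = 0" "k \<ge> 2" | "i = 1" "k \<ge> 2" | "i = 2" "k \<ge> 1"
      using assms by fastforce
    then show ?thesis
    proof cases
      case 1
      then have "N = 3 * (k - 2) + 6" "k - 1 = k - 2 + 1" using assms(2) by auto
      then show ?thesis
        using half [OF max_chain_paths_closed_form(1) [of "k - 2"]] 1 by simp
    next
      case 2
      then have "N = 3 * (k - 2) + 7" using assms(2) by auto
      then show ?thesis
        using half [OF max_chain_paths_closed_form(2) [of "k - 2"]] 2 by simp
    next
      case 3
      then have "N = 3 * (k - 1) + 5" using assms(2) by auto
      then show ?thesis
        using half [OF max_chain_paths_closed_form(3) [of "k - 1"]] 3 by simp
    qed
  qed
  then show ?thesis
    by (auto simp: SP_star_eq max_chain_paths_in_sink_path_counts intro: sink_path_counts_le)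
qed

end
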